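(* Let $m\ge 1$ be an integer and let $n \ge 3$ be the smallest integer such that the extended Lucas cube $\mathrm{ELC}(n)$ has at least $m$ vertices. Then the linear array with $m$ nodes (the path graph on $m$ vertices) can be embedded into $\mathrm{ELC}(n)$ with dilation 1.
   Context: Define sets of binary strings $V_1(k)$, consisting of strings of length $k-2$, by $V_1(2)=\{\lambda\}$ ($\lambda$ the empty string), $V_1(3)=\{0,1\}$, $V_1(4)=\{00,01,10,11\}$, and $V_1(k)=0V_1(k-1)\cup 10V_1(k-2)$ for $k\ge 5$, where $uS=\{us: s\in S\}$ denotes concatenation. Define sets of binary strings $V_2(k)$, consisting of strings of length $k-2$, by $V_2(3)=\{0,1\}$, $V_2(4)=\{00,01,10,11\}$ and, for $k\ge 5$, $V_2(k)=0V_1(k-1)\cup 10V_1(k-3)0$, where $10S0=\{10s0: s\in S\}$. For $k\ge 3$, the extended Lucas cube $\mathrm{ELC}(k)$ is the simple undirected graph with vertex set $V_2(k)$ in which two vertices are adjacent if and only if they differ in exactly one bit position. An embedding of a graph $G$ into a graph $H$ is an injective map $g$ from the vertices of $G$ to the vertices of $H$. Its dilation is the maximum distance in $H$ between images of adjacent vertices of $G$; thus $g$ is an embedding with dilation 1 if it is injective and maps adjacent vertices to adjacent vertices (for a graph $G$ with no edges, any embedding counts as dilation 1). *)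

theory Defs
  imports "HOL-Library.Z2" "Graph_Theory.Graph_Theory"
begin

text \<open>Binary strings are lists over the two-element type \<open>bit\<close>. Both families of
  sets are given the dummy value \<open>{}\<close> at the indices where they are not defined.\<close>

fun V1 :: "nat \<Rightarrow> bit list set" where
  "V1 k =
    (if k = 2 then {[]}
     else if k = 3 then {[0], [1]}
     else if k = 4 then {[0, 0], [0, 1], [1, 0], [1, 1]}
     else if k \<ge> 5 then (\<lambda>s. [0] @ s) ` V1 (k - 1) \<union> (\<lambda>s. [1, 0] @ s) ` V1 (k - 2)
     else {})"

declare V1.simps [simp del]

definition V2 :: "nat \<Rightarrow> bit list set" where
  "V2 k =
    (if k = 3 then {[0], [1]}
     else if k = 4 then {[0, 0], [0, 1], [1, 0], [1, 1]}
     else if k \<ge> 5 then (\<lambda>s. [0] @ s) ` V1 (k - 1) \<union> (\<lambda>s. [1, 0] @ s @ [0]) ` V1 (k - 3)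
     else {})"

definition differ_in_one_bit :: "bit list \<Rightarrow> bit list \<Rightarrow> bool" where
  "differ_in_one_bit u v \<longleftrightarrow> length u = length v \<and> (\<exists>!i. i < length u \<and> u ! i \<noteq> v ! i)"

text \<open>A simple undirected graph is a loop-free symmetric digraph without parallel arcs
  (locale \<open>pair_graph\<close>): every undirected edge is represented by its two orientations.\<close>

definition ELC :: "nat \<Rightarrow> bit list pair_pre_digraph" where
  "ELC k = \<lparr> pverts = V2 k, parcs = {(u, v). u \<in> V2 k \<and> v \<in> V2 k \<and> differ_in_one_bit u v} \<rparr>"

definition linear_array :: "nat \<Rightarrow> nat pair_pre_digraph" where
  "linear_array m =
    \<lparr> pverts = {0..<m}, parcs = {(i, j). i < m \<and> j < m \<and> (j = Suc i \<or> i = Suc j)} \<rparr>"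

text \<open>Distance is the least number of arcs on a walk (\<open>\<infinity>\<close> if there is none).\<close>

definition graph_dist :: "'a pair_pre_digraph \<Rightarrow> 'a \<Rightarrow> 'a \<Rightarrow> ereal" where
  "graph_dist H u v = wf_digraph.\<mu> (with_proj H) (\<lambda>_. 1) u v"

definition embedding :: "'a pair_pre_digraph \<Rightarrow> 'b pair_pre_digraph \<Rightarrow> ('a \<Rightarrow> 'b) \<Rightarrow> bool" where
  "embedding G H g \<longleftrightarrow> inj_on g (pverts G) \<and> g ` pverts G \<subseteq> pverts H"

text \<open>For a finite graph with at least one edge this supremum is a maximum.\<close>

definition dilation :: "'a pair_pre_digraph \<Rightarrow> 'b pair_pre_digraph \<Rightarrow> ('a \<Rightarrow> 'b) \<Rightarrow> ereal" where
  "dilation G H g = (SUP (u, v)\<in>parcs G. graph_dist H (g u) (g v))"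

text \<open>By convention every embedding of an edgeless graph counts as having dilation 1.\<close>

definition dilation_one_embedding ::
    "'a pair_pre_digraph \<Rightarrow> 'b pair_pre_digraph \<Rightarrow> ('a \<Rightarrow> 'b) \<Rightarrow> bool" where
  "dilation_one_embedding G H g \<longleftrightarrow> embedding G H g \<and> (parcs G = {} \<or> dilation G H g = 1)"

lemma finite_V1: "finite (V1 k)"
proof (induction k rule: less_induct)
  case (less k)
  then show ?case by (subst V1.simps) auto
qed

lemma finite_V2: "finite (V2 k)"
  by (simp add: V2_def finite_V1)

lemma length_V1: "s \<in> V1 k \<Longrightarrow> length s = k - 2"
proof (induction k arbitrary: s rule: less_induct)
  case (less k)
  show ?case
  proof (cases "k \<ge> 5")
    case True
    then have "V1 k = (\<lambda>s. [0] @ s) ` V1 (k - 1) \<union> (\<lambda>s. [1, 0] @ s) ` V1 (k - 2)"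
      by (subst V1.simps) auto
    with less.prems obtain t where
      "s = [0] @ t \<and> t \<in> V1 (k - 1) \<or> s = [1, 0] @ t \<and> t \<in> V1 (k - 2)" by blast
    then show ?thesis using less.IH[of "k - 1" t] less.IH[of "k - 2" t] True by auto
  next
    case False
    with less.prems show ?thesis by (subst (asm) V1.simps) (auto split: if_splits)
  qed
qed

lemma length_V2: "s \<in> V2 k \<Longrightarrow> length s = k - 2"
  by (auto simp: V2_def split: if_splits dest!: length_V1)

lemma pair_graph_ELC: "pair_graph (ELC k)"
proof
  show "finite (parcs (ELC k))"
    by (rule finite_subset[of _ "V2 k \<times> V2 k"]) (auto simp: ELC_def finite_V2)
  show "symmetric (with_proj (ELC k))"
    by (auto simp: symmetric_def ELC_def differ_in_one_bit_def intro!: symI)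
qed (auto simp: ELC_def finite_V2 differ_in_one_bit_def)

lemma pair_graph_linear_array: "pair_graph (linear_array m)"
proof
  show "finite (parcs (linear_array m))"
    by (rule finite_subset[of _ "{0..<m} \<times> {0..<m}"]) (auto simp: linear_array_def)
  show "symmetric (with_proj (linear_array m))"
    by (auto simp: symmetric_def linear_array_def intro!: symI)
qed (auto simp: linear_array_def)

lemma graph_dist_ge_1:
  assumes "pair_graph H" "u \<noteq> v"
  shows "graph_dist H u v \<ge> 1"
proof -
  interpret pair_graph H by fact
  show ?thesis unfolding graph_dist_def \<mu>_def
  proof (rule INF_greatest, clarify)
    fix p assume "awalk u p v"
    then have "p \<noteq> []" using assms(2) by (auto simp: awalk_def)
    then show "1 \<le> ereal (awalk_cost (\<lambda>_. 1) p)"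
      by (cases p) (auto simp: awalk_cost_def sum_list_triv)
  qed
qed

lemma graph_dist_le_1_iff:
  assumes "pair_graph H" "u \<noteq> v"
  shows "graph_dist H u v \<le> 1 \<longleftrightarrow> (u, v) \<in> parcs H"
proof -
  interpret pair_graph H by fact
  show ?thesis
  proof
    assume "(u, v) \<in> parcs H"
    then have "awalk u [(u, v)] v" by (auto simp: awalk_def in_arcsD1)
    from min_cost_le_walk_cost[OF this, of "\<lambda>_. 1"]
    show "graph_dist H u v \<le> 1" by (simp add: graph_dist_def one_ereal_def)
  next
    assume "graph_dist H u v \<le> 1"
    then have "graph_dist H u v < 2"
      by (rule le_less_trans) simp
    then obtain p where p: "awalk u p v" "ereal (awalk_cost (\<lambda>_. 1) p) < 2"
      unfolding graph_dist_def \<mu>_def by (auto simp: INF_less_iff)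
    then have "length p < 2"
      by (simp add: awalk_cost_def sum_list_triv)
    moreover have "p \<noteq> []" using p assms(2) by (auto simp: awalk_def)
    ultimately obtain e where "p = [e]" by (cases p) auto
    with p(1) show "(u, v) \<in> parcs H" by (auto simp: awalk_def)
  qed
qed

lemma dilation_one_embedding_iff:
  assumes "pair_graph G" "pair_graph H"
  shows "dilation_one_embedding G H g \<longleftrightarrow>
    embedding G H g \<and> (\<forall>(u, v)\<in>parcs G. (g u, g v) \<in> parcs H)"
proof (cases "embedding G H g \<and> parcs G \<noteq> {}")
  case True
  interpret G: pair_graph G by fact
  have neq: "g u \<noteq> g v" if "(u, v) \<in> parcs G" for u v
    using that True G.no_loops'[OF that] G.in_arcsD1[OF that] G.in_arcsD2[OF that]
    by (auto simp: embedding_def inj_on_def)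
  have "1 \<le> dilation G H g"
  proof -
    from True obtain u v where uv: "(u, v) \<in> parcs G" by auto
    have "1 \<le> graph_dist H (g u) (g v)" by (rule graph_dist_ge_1[OF assms(2) neq[OF uv]])
    also have "\<dots> \<le> dilation G H g" unfolding dilation_def
      by (rule SUP_upper2[OF uv]) simp
    finally show ?thesis .
  qed
  then have "dilation G H g = 1 \<longleftrightarrow> dilation G H g \<le> 1" by auto
  also have "\<dots> \<longleftrightarrow> (\<forall>(u, v)\<in>parcs G. graph_dist H (g u) (g v) \<le> 1)"
    unfolding dilation_def by (simp add: SUP_le_iff case_prod_beta)
  also have "\<dots> \<longleftrightarrow> (\<forall>(u, v)\<in>parcs G. (g u, g v) \<in> parcs H)"
    using graph_dist_le_1_iff[OF assms(2) neq] by blast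
  finally show ?thesis using True by (simp add: dilation_one_embedding_def)
qed (auto simp: dilation_one_embedding_def)

end

theory Submission
  imports Defs
begin

text \<open>It suffices that every \<open>ELC(k)\<close> has a Hamiltonian path, since a path with \<open>m\<close> nodes is
  then an initial segment of it. The set \<open>V\<^sub>1(k)\<close> consists of the strings of length
  \<open>k - 3\<close> without two consecutive ones, followed by an arbitrary bit. The former have a
  Gray code, so \<open>V\<^sub>1(k)\<close> is a prism over a path and has a Hamiltonian cycle; hence it has a
  Hamiltonian path starting at any prescribed vertex. In \<open>V\<^sub>2(k)\<close> the paths of
  \<open>0 V\<^sub>1(k-1)\<close> and \<open>1 0 V\<^sub>1(k-3) 0\<close> that start at the string \<open>0\<dots>0\<close> and at the string
  \<open>1 0\<dots>0\<close> can then be joined.\<close>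

lemma differ_in_one_bit_Nil [simp]: "\<not> differ_in_one_bit [] v"
  by (auto simp: differ_in_one_bit_def)

text \<open>With equal heads, the differing positions are those of the tails shifted by one; with
  distinct heads, position 0 is already the only one allowed. As a simp rule this replaces indices
  by recursion on lists.\<close>

lemma differ_in_one_bit_Cons [simp]:
  "differ_in_one_bit (a # u) (b # v) \<longleftrightarrow> a = b \<and> differ_in_one_bit u v \<or> a \<noteq> b \<and> u = v"
proof -
  have "(\<exists>!i. i < length (a # u) \<and> (a # u) ! i \<noteq> (b # v) ! i) \<longleftrightarrow>
      a = b \<and> (\<exists>!i. i < length u \<and> u ! i \<noteq> v ! i) \<or>
      a \<noteq> b \<and> (\<forall>i<length u. u ! i = v ! i)" (is "?L \<longleftrightarrow> ?R")
  proof (cases "a = b")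
    case True
    have shift: "(i < length (a # u) \<and> (a # u) ! i \<noteq> (b # v) ! i) \<longleftrightarrow>
        (\<exists>j. i = Suc j \<and> j < length u \<and> u ! j \<noteq> v ! j)" for i
      using True by (cases i) auto
    have "?L \<longleftrightarrow> (\<exists>!j. j < length u \<and> u ! j \<noteq> v ! j)"
      unfolding shift by (auto simp: Ex1_def)
    then show ?thesis using True by simp
  next
    case False
    have "?L \<longleftrightarrow> (\<forall>i<length u. u ! i = v ! i)"
    proof
      assume ?L
      moreover have "0 < length (a # u) \<and> (a # u) ! 0 \<noteq> (b # v) ! 0" using False by simp
      ultimately show "\<forall>i<length u. u ! i = v ! i"
        by (metis Suc_less_eq length_Cons nat.distinct(1) nth_Cons_Suc)
    next
      assume "\<forall>i<length u. u ! i = v ! i"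
      then show ?L using False
        by (intro ex1I[of _ 0]) (auto simp: nth_Cons split: nat.splits)
    qed
    then show ?thesis using False by simp
  qed
  then show ?thesis by (auto simp: differ_in_one_bit_def list_eq_iff_nth_eq)
qed

lemma differ_in_one_bit_sym: "differ_in_one_bit u v \<longleftrightarrow> differ_in_one_bit v u"
  unfolding differ_in_one_bit_def by (metis (no_types, lifting))

lemma differ_in_one_bit_append_same:
  "differ_in_one_bit (u @ w) (v @ w)" if "differ_in_one_bit u v"
proof -
  have "length u = length v" using that by (simp add: differ_in_one_bit_def)
  then show ?thesis using that by (induction u v rule: list_induct2) auto
qed

lemma differ_in_one_bit_append_single [simp]:
  "differ_in_one_bit (u @ [a]) (u @ [b]) \<longleftrightarrow> a \<noteq> b"
  by (induction u) auto

lemma successively_differ_map: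
  assumes "successively differ_in_one_bit xs"
    and "\<And>u v. differ_in_one_bit u v \<Longrightarrow> differ_in_one_bit (f u) (f v)"
  shows "successively differ_in_one_bit (map f xs)"
  using assms by (auto simp: successively_map elim: successively_mono)

text \<open>Reversing a list flips the relation under \<open>successively\<close>; this removes the
  flip.\<close>

lemma successively_differ_swap [simp]:
  "successively (\<lambda>u v. differ_in_one_bit v u) xs \<longleftrightarrow> successively differ_in_one_bit xs"
  by (rule successively_cong[OF _ refl]) (rule differ_in_one_bit_sym)

text \<open>A Gray code of the strings of length \<open>n\<close> without two consecutive ones. Both
  blocks are reversed so that they fit: the first ends in \<open>0 # hd (gray (Suc n))\<close>, the
  second begins with \<open>1 # 0 # last (gray n)\<close>, and by \<open>hd_gray_Suc\<close> only
  the leading bit differs.\<close>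

fun gray :: "nat \<Rightarrow> bit list list" where
  "gray 0 = [[]]"
| "gray (Suc 0) = [[0], [1]]"
| "gray (Suc (Suc n)) =
    map ((#) 0) (rev (gray (Suc n))) @ map (\<lambda>s. 1 # 0 # s) (rev (gray n))"

lemma gray_not_Nil [simp]: "gray n \<noteq> []"
  by (induction n rule: gray.induct) auto

lemma distinct_gray: "distinct (gray n)"
  by (induction n rule: gray.induct) (auto simp: distinct_map inj_on_def)

lemma length_gray_gt: "n < length (gray n)"
proof (induction n rule: gray.induct)
  case (3 n)
  have "0 < length (gray n)" by simp
  with 3 show ?case by (simp del: length_greater_0_conv)
qed auto

lemma hd_gray_Suc: "hd (gray (Suc n)) = 0 # last (gray n)"
  by (cases n) (auto simp: hd_append hd_map hd_rev)

lemma successively_gray: "successively differ_in_one_bit (gray n)"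
proof (induction n rule: gray.induct)
  case (3 n)
  then show ?case
    by (auto simp: successively_append_iff last_map last_rev hd_map hd_rev hd_gray_Suc
        intro!: successively_differ_map)
qed auto

text \<open>Both sides obey the same recursion, and the shift by 3 matches \<open>V1 3\<close> and
  \<open>V1 4\<close> with \<open>gray 0\<close> and \<open>gray 1\<close>.\<close>

lemma V1_eq_gray: "V1 (n + 3) = (\<Union>s\<in>set (gray n). {s @ [0], s @ [1]})"
proof (induction n rule: gray.induct)
  case (3 n)
  have "V1 (Suc (Suc n) + 3) = (#) 0 ` V1 (Suc n + 3) \<union> (\<lambda>s. 1 # 0 # s) ` V1 (n + 3)"
    by (subst V1.simps) (simp add: eval_nat_numeral)
  then show ?case by (simp only: 3) auto
qed (subst V1.simps; auto)+

definition hamiltonian_list :: "bit list set \<Rightarrow> bit list list \<Rightarrow> bool" where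
  "hamiltonian_list S xs \<longleftrightarrow> distinct xs \<and> set xs = S \<and> successively differ_in_one_bit xs"

lemma hamiltonian_list_V1_from:
  assumes "v \<in> V1 (n + 3)"
  shows "\<exists>xs. hamiltonian_list (V1 (n + 3)) (v # xs)"
proof -
  \<comment> \<open>Forward along the layer ending in 0, back along the layer ending in 1: the turn
    and the closing edge change only the last bit.\<close>
  define cyc where "cyc = map (\<lambda>s. s @ [0]) (gray n) @ map (\<lambda>s. s @ [1]) (rev (gray n))"
  have path: "distinct cyc" "set cyc = V1 (n + 3)" "successively differ_in_one_bit cyc"
    unfolding cyc_def V1_eq_gray
    by (auto simp: distinct_map distinct_gray inj_on_def successively_append_iff successively_gray
        last_map hd_map hd_rev intro!: successively_differ_map differ_in_one_bit_append_same)
  have closed: "differ_in_one_bit (last cyc) (hd cyc)"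
    by (simp add: cyc_def last_map last_rev hd_append hd_map)
  from assms path(2) obtain ys zs where "cyc = ys @ v # zs"
    by (metis split_list)
  \<comment> \<open>Rotate to start at \<open>v\<close>; the closing edge joins the two
    pieces.\<close>
  then have "hamiltonian_list (V1 (n + 3)) (v # zs @ ys)"
    using path closed
    by (cases "ys = []"; cases "zs = []")
      (auto simp: hamiltonian_list_def successively_append_iff successively_Cons)
  then show ?thesis by blast
qed

lemma replicate_0_in_V1: "k \<ge> 2 \<Longrightarrow> replicate (k - 2) 0 \<in> V1 k"
proof (induction k rule: less_induct)
  case (less k)
  consider "k = 2" | "k = 3" | "k = 4" | "k \<ge> 5" using less.prems by linarith
  then show ?case
  proof cases
    case 4
    then obtain j where "k = j + 5" by (metis le_add_diff_inverse2)
    then have "replicate (k - 2) 0 = (0 :: bit) # replicate (k - 1 - 2) 0"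
      by (simp flip: replicate_Suc)
    then show ?thesis using less.IH[of "k - 1"] 4
      by (subst V1.simps) (simp add: image_iff)
  qed (subst V1.simps; simp add: numeral_2_eq_2)+
qed

text \<open>The index 2 is not of the form \<open>n + 3\<close> and is treated by hand; it occurs as
  \<open>k - 3\<close> in \<open>V2 5\<close>.\<close>

lemma hamiltonian_list_V1_from_0:
  assumes "k \<ge> 2"
  shows "\<exists>xs. hamiltonian_list (V1 k) (replicate (k - 2) 0 # xs)"
proof (cases "k = 2")
  case True
  then have "hamiltonian_list (V1 k) (replicate (k - 2) 0 # [])"
    by (subst V1.simps) (simp add: hamiltonian_list_def)
  then show ?thesis by blast
next
  case False
  with assms have "k = (k - 3) + 3" by simp
  with hamiltonian_list_V1_from replicate_0_in_V1[OF assms] show ?thesis by metis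
qed

lemma hamiltonian_list_V2:
  assumes "k \<ge> 3"
  shows "\<exists>xs. hamiltonian_list (V2 k) xs"
proof -
  consider "k = 3" | "k = 4" | "k \<ge> 5" using assms by linarith
  then show ?thesis
  proof cases
    case 1
    then have "hamiltonian_list (V2 k) [[0], [1]]"
      by (auto simp: hamiltonian_list_def V2_def)
    then show ?thesis by blast
  next
    case 2
    then have "hamiltonian_list (V2 k) [[0, 0], [0, 1], [1, 1], [1, 0]]"
      by (auto simp: hamiltonian_list_def V2_def)
    then show ?thesis by blast
  next
    case 3
    then have sub: "k - 1 - 2 = k - 3" "k - 3 - 2 = k - 5" by simp_all
    obtain xs where xs: "hamiltonian_list (V1 (k - 1)) (replicate (k - 3) 0 # xs)"
      using hamiltonian_list_V1_from_0[of "k - 1"] 3 unfolding sub by fastforce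
    obtain ys where ys: "hamiltonian_list (V1 (k - 3)) (replicate (k - 5) 0 # ys)"
      using hamiltonian_list_V1_from_0[of "k - 3"] 3 unfolding sub by fastforce
    let ?xs = "replicate (k - 3) 0 # xs" and ?ys = "replicate (k - 5) 0 # ys"
    let ?f = "\<lambda>s. 1 # 0 # s @ [0 :: bit]"
    \<comment> \<open>The first path is reversed so that it ends in the zero string.\<close>
    let ?p = "rev (map ((#) 0) ?xs) @ map ?f ?ys"
    \<comment> \<open>In this form the zero string is visibly the tail of
      \<open>?f (replicate (k - 5) 0)\<close>, so the two ends at the junction differ only in their
      leading bit.\<close>
    have "replicate (k - 3) (0 :: bit) = 0 # replicate (k - 5) 0 @ [0]"
    proof -
      from 3 have "k - 3 = Suc (Suc (k - 5))" by simp
      then show ?thesis by (simp add: replicate_append_same)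
    qed
    then have join: "differ_in_one_bit (last (rev (map ((#) 0) ?xs))) (hd (map ?f ?ys))"
      by simp
    have "successively differ_in_one_bit (map ((#) 0) ?xs)"
      "successively differ_in_one_bit (map ?f ?ys)"
      by (rule successively_differ_map; use xs ys in
          \<open>force simp: hamiltonian_list_def intro: differ_in_one_bit_append_same\<close>)+
    with join have "successively differ_in_one_bit ?p"
      unfolding successively_append_iff successively_rev successively_differ_swap by blast
    moreover have "distinct ?p"
      using xs ys unfolding hamiltonian_list_def distinct_append distinct_rev distinct_map
      by (auto simp: inj_on_def)
    moreover have "set ?p = V2 k"
    proof -
      have "set ?p = (#) 0 ` set ?xs \<union> ?f ` set ?ys" by (simp only: set_append set_rev set_map)
      then show ?thesis using 3 xs ys by (simp add: V2_def hamiltonian_list_def del: set_simps)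
    qed
    ultimately show ?thesis by (auto simp only: hamiltonian_list_def)
  qed
qed

text \<open>Ensures that the least index in the theorem exists. \<open>V2 (m + 5)\<close> contains a
  copy of \<open>V1 (m + 4)\<close>, which has at least one string for each entry of
  \<open>gray (Suc m)\<close>.\<close>

lemma card_V2_unbounded: "m \<le> card (V2 (m + 5))"
proof -
  let ?V = "V1 (Suc m + 3)"
  have "m \<le> card ((\<lambda>s. s @ [0]) ` set (gray (Suc m)))"
    using length_gray_gt[of "Suc m"]
    by (subst card_image) (auto simp: inj_on_def distinct_card[OF distinct_gray])
  also have "\<dots> \<le> card ?V"
    by (intro card_mono finite_V1) (auto simp only: V1_eq_gray)
  also have "\<dots> = card ((#) 0 ` ?V)"
    by (simp add: card_image)
  also have "\<dots> \<le> card (V2 (m + 5))"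
    by (intro card_mono finite_V2) (auto simp: V2_def eval_nat_numeral)
  finally show ?thesis .
qed

theorem theorem2:
  fixes m n :: nat
  assumes "m \<ge> 1"
    and "n = (LEAST k. k \<ge> 3 \<and> card (pverts (ELC k)) \<ge> m)"
  shows "\<exists>g. dilation_one_embedding (linear_array m) (ELC n) g"
proof -
  have "m + 5 \<ge> 3 \<and> card (pverts (ELC (m + 5))) \<ge> m"
    using card_V2_unbounded by (simp add: ELC_def)
  then have n: "n \<ge> 3" "card (V2 n) \<ge> m"
    unfolding assms(2) by (metis (mono_tags, lifting) LeastI ELC_def pair_pre_digraph.select_convs(1))+
  from hamiltonian_list_V2[OF n(1)] obtain xs where xs: "distinct xs" "set xs = V2 n"
      "successively differ_in_one_bit xs"
    by (auto simp: hamiltonian_list_def)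
  have len: "m \<le> length xs" using n(2) xs distinct_card by metis
  have "differ_in_one_bit (xs ! i) (xs ! Suc i)" if "Suc i < m" for i
    using xs(3) that len by (auto simp: successively_conv_nth)
  \<comment> \<open>Node \<open>i\<close> goes to entry \<open>i\<close> of the Hamiltonian path.
    Each edge of the array is a pair of opposite arcs, hence the appeal to symmetry.\<close>
  then have "embedding (linear_array m) (ELC n) ((!) xs) \<and>
      (\<forall>(u, v)\<in>parcs (linear_array m). (xs ! u, xs ! v) \<in> parcs (ELC n))"
    using len xs(1) differ_in_one_bit_sym
    by (auto simp: embedding_def linear_array_def ELC_def inj_on_def nth_eq_iff_index_eq
        simp flip: xs(2))
  then show ?thesis
    using dilation_one_embedding_iff[OF pair_graph_linear_array pair_graph_ELC] by blast
qed

end
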